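(* For $n\ge0$ let $\mathcal R_n$ be the set of zigzag knight's paths of size $2n$ (ending on the $x$-axis), $\mathcal R=\bigcup_n\mathcal R_n$, and let $\mathcal M_n$ be the set of peakless Motzkin paths of length $n$, $\mathcal M=\bigcup_n\mathcal M_n$. Define $\psi:\mathcal R\to\mathcal M$ recursively (writing paths as words): $\psi(\epsilon)=F$; $\psi(E\bar E\beta)=U\psi(\beta)D$; $\psi(N\bar N\beta)=F\psi(\beta)$; $\psi(N\bar E\beta E\bar N\gamma)=U\psi(\beta)D\psi(\gamma)$, for $\beta,\gamma\in\mathcal R$. Then for every $n\ge0$, $\psi$ induces a bijection between $\mathcal R_n$ and $\mathcal M_{n+1}$.
   Context: Let $N=(1,2)$, $\bar N=(1,-2)$, $E=(2,1)$, $\bar E=(2,-1)$; $N,E$ are up-steps and $\bar N,\bar E$ are down-steps. A knight's path is a lattice path in $\mathbb N^2$ starting at $(0,0)$, ending on the $x$-axis, with steps in $\{N,\bar N,E,\bar E\}$. A zigzag knight's path is a knight's path in which consecutive steps alternate between up-steps and down-steps; $\epsilon$ is the empty path. The size of a path is the abscissa of its last point. Every nonempty zigzag knight's path can be written uniquely in one of the forms $N\bar N\beta$, $E\bar E\beta$, $N\bar E\beta E\bar N\gamma$ with $\beta,\gamma$ (possibly empty) zigzag knight's paths. A peakless Motzkin path of length $n$ is a lattice path in $\mathbb N^2$ from $(0,0)$ to $(n,0)$ with steps $U=(1,1)$, $D=(1,-1)$, $F=(1,0)$ containing no occurrence of $UD$ (consecutive steps $U$ then $D$). *)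

theory Defs
  imports Main "HOL-Library.Product_Plus" "HOL-Library.Sublist"
begin

text \<open>Paths are represented by their words of steps; the vertices of a path are recovered as the
  end points of its prefixes, starting from \<^term>\<open>(0, 0) :: int \<times> int\<close>.\<close>

definition endpoint :: "('s \<Rightarrow> int \<times> int) \<Rightarrow> 's list \<Rightarrow> int \<times> int" where
  "endpoint v p = sum_list (map v p)"

definition in_quadrant :: "('s \<Rightarrow> int \<times> int) \<Rightarrow> 's list \<Rightarrow> bool" where
  "in_quadrant v p \<longleftrightarrow> (\<forall>k\<le>length p. endpoint v (take k p) \<in> {0..} \<times> {0..})"

datatype knight_step = N | Nbar | E | Ebar

fun knight_vec :: "knight_step \<Rightarrow> int \<times> int" where
  "knight_vec N = (1, 2)"
| "knight_vec Nbar = (1, -2)"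
| "knight_vec E = (2, 1)"
| "knight_vec Ebar = (2, -1)"

definition up_step :: "knight_step \<Rightarrow> bool" where
  "up_step s \<longleftrightarrow> s \<in> {N, E}"

definition knight_path :: "knight_step list \<Rightarrow> bool" where
  "knight_path p \<longleftrightarrow> in_quadrant knight_vec p \<and> snd (endpoint knight_vec p) = 0"

definition zigzag_knight_path :: "knight_step list \<Rightarrow> bool" where
  "zigzag_knight_path p \<longleftrightarrow> knight_path p \<and> successively (\<lambda>s t. up_step s \<noteq> up_step t) p"

definition path_size :: "knight_step list \<Rightarrow> int" where
  "path_size p = fst (endpoint knight_vec p)"

definition zigzag_knight_paths :: "nat \<Rightarrow> knight_step list set" where
  "zigzag_knight_paths n = {p. zigzag_knight_path p \<and> path_size p = 2 * int n}"

datatype motzkin_step = U | D | F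

fun motzkin_vec :: "motzkin_step \<Rightarrow> int \<times> int" where
  "motzkin_vec U = (1, 1)"
| "motzkin_vec D = (1, -1)"
| "motzkin_vec F = (1, 0)"

definition peakless_motzkin_paths :: "nat \<Rightarrow> motzkin_step list set" where
  "peakless_motzkin_paths n =
     {p. in_quadrant motzkin_vec p \<and> endpoint motzkin_vec p = (int n, 0) \<and> \<not> sublist [U, D] p}"

text \<open>Auxiliary, used only to establish the unique decomposition of zigzag knight's paths that
  makes the recursion for \<open>psi\<close> below well defined: a zigzag path that starts at height \<open>h\<close> with
  an up-step (or is empty) and ends on the axis, read two steps at a time.\<close>

fun zz_from :: "nat \<Rightarrow> knight_step list \<Rightarrow> bool" where
  "zz_from h [] = (h = 0)"
| "zz_from h (N # Nbar # p) = zz_from h p"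
| "zz_from h (E # Ebar # p) = zz_from h p"
| "zz_from h (N # Ebar # p) = zz_from (Suc h) p"
| "zz_from (Suc h) (E # Nbar # p) = zz_from h p"
| "zz_from _ _ = False"

fun heights_ok :: "int \<Rightarrow> knight_step list \<Rightarrow> bool" where
  "heights_ok h [] = (h = 0)"
| "heights_ok h (s # p) = (h \<ge> 0 \<and> heights_ok (h + snd (knight_vec s)) p)"

lemma endpoint_Nil [simp]: "endpoint v [] = 0"
  by (simp add: endpoint_def)

lemma endpoint_Cons [simp]: "endpoint v (s # p) = v s + endpoint v p"
  by (simp add: endpoint_def)

lemma fst_endpoint_nonneg: "0 \<le> fst (endpoint knight_vec p)"
proof (induction p)
  case (Cons s p)
  then show ?case by (cases s) auto
qed simp

lemma heights_ok_iff:
  "heights_ok h p \<longleftrightarrow> (\<forall>k\<le>length p. 0 \<le> h + snd (endpoint knight_vec (take k p))) \<and>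
     h + snd (endpoint knight_vec p) = 0"
proof (induction p arbitrary: h)
  case (Cons s p)
  have "(\<forall>k\<le>length (s # p). 0 \<le> h + snd (endpoint knight_vec (take k (s # p)))) \<longleftrightarrow>
    0 \<le> h \<and> (\<forall>k\<le>length p. 0 \<le> h + snd (knight_vec s) + snd (endpoint knight_vec (take k p)))"
    (is "?L \<longleftrightarrow> ?R")
  proof
    assume L: ?L
    show ?R
    proof (intro conjI allI impI)
      show "0 \<le> h" using L[rule_format, of 0] by simp
      show "0 \<le> h + snd (knight_vec s) + snd (endpoint knight_vec (take k p))"
        if "k \<le> length p" for k
        using L[rule_format, of "Suc k"] that by (simp add: add.assoc)
    qed
  next
    assume R: ?R
    show ?L
    proof (intro allI impI)
      fix k assume "k \<le> length (s # p)"
      then show "0 \<le> h + snd (endpoint knight_vec (take k (s # p)))"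
        using R by (cases k) (auto simp: add.assoc)
    qed
  qed
  with Cons.IH[of "h + snd (knight_vec s)"] show ?case
    by (auto simp: add.assoc)
qed auto

lemma knight_path_iff: "knight_path p \<longleftrightarrow> heights_ok 0 p"
  using fst_endpoint_nonneg
  by (auto simp: knight_path_def heights_ok_iff in_quadrant_def mem_Times_iff)

lemma heights_ok_nonneg: "heights_ok h p \<Longrightarrow> 0 \<le> h"
  by (cases p) auto

lemma zz_from_iff:
  "zz_from h p \<longleftrightarrow> heights_ok (int h) p \<and> successively (\<lambda>s t. up_step s \<noteq> up_step t) p \<and>
     (p \<noteq> [] \<longrightarrow> up_step (hd p))"
  by (induction h p rule: zz_from.induct)
    (auto simp: up_step_def successively_Cons add.commute dest: heights_ok_nonneg)

lemma zigzag_iff: "zigzag_knight_path p \<longleftrightarrow> zz_from 0 p"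
proof -
  have "up_step (hd p)" if "heights_ok 0 p" "p \<noteq> []"
    using that by (cases p; cases "hd p") (auto simp: up_step_def dest: heights_ok_nonneg)
  then show ?thesis
    by (auto simp: zigzag_knight_path_def knight_path_iff zz_from_iff)
qed

lemma zz_from_append: "zz_from k q \<Longrightarrow> zz_from (Suc (k + j)) (q @ E # Nbar # r) = zz_from j r"
  by (induction k q rule: zz_from.induct) auto

lemma zz_from_first_return:
  "zz_from (Suc h) p \<Longrightarrow> \<exists>q r. p = q @ E # Nbar # r \<and> zz_from 0 q \<and> zz_from h r"
proof (induction "length p" arbitrary: h p rule: less_induct)
  case less
  from less.prems show ?case
  proof (cases "(Suc h, p)" rule: zz_from.cases)
    case (2 h' p')
    then obtain q r where "p' = q @ E # Nbar # r" "zz_from 0 q" "zz_from h r"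
      using less.hyps[of p' h] less.prems by auto
    with 2 show ?thesis by (intro exI[of _ "N # Nbar # q"] exI[of _ r]) auto
  next
    case (3 h' p')
    then obtain q r where "p' = q @ E # Nbar # r" "zz_from 0 q" "zz_from h r"
      using less.hyps[of p' h] less.prems by auto
    with 3 show ?thesis by (intro exI[of _ "E # Ebar # q"] exI[of _ r]) auto
  next
    case (4 h' p')
    then obtain q r where 1: "p' = q @ E # Nbar # r" "zz_from 0 q" "zz_from (Suc h) r"
      using less.hyps[of p' "Suc h"] less.prems by auto
    then obtain q' r' where 2: "r = q' @ E # Nbar # r'" "zz_from 0 q'" "zz_from h r'"
      using less.hyps[of r h] 4 by auto
    with 1 4 zz_from_append[of 0 q 0 q'] show ?thesis
      by (intro exI[of _ "N # Ebar # q @ E # Nbar # q'"] exI[of _ r']) auto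
  next
    case (5 h' p')
    with less.prems show ?thesis by (intro exI[of _ "[]"] exI[of _ p']) auto
  qed auto
qed

lemma zz_from_unique:
  "zz_from k q \<Longrightarrow> zz_from k q' \<Longrightarrow> q @ E # Nbar # r = q' @ E # Nbar # r' \<Longrightarrow> q = q' \<and> r = r'"
proof (induction k q arbitrary: q' rule: zz_from.induct)
  case (1 h)
  then show ?case by (cases "(h, q')" rule: zz_from.cases) auto
next
  case (2 h p)
  then show ?case by (cases "(h, q')" rule: zz_from.cases) auto
next
  case (3 h p)
  then show ?case by (cases "(h, q')" rule: zz_from.cases) auto
next
  case (4 h p)
  then show ?case by (cases "(h, q')" rule: zz_from.cases) auto
next
  case (5 h p)
  then show ?case by (cases "(Suc h, q')" rule: zz_from.cases) auto
qed auto

lemma zigzag_Nil: "zigzag_knight_path []"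
  and zigzag_EE: "zigzag_knight_path \<beta> \<Longrightarrow> zigzag_knight_path (E # Ebar # \<beta>)"
  and zigzag_NN: "zigzag_knight_path \<beta> \<Longrightarrow> zigzag_knight_path (N # Nbar # \<beta>)"
  and zigzag_NE: "zigzag_knight_path \<beta> \<Longrightarrow> zigzag_knight_path \<gamma> \<Longrightarrow>
    zigzag_knight_path (N # Ebar # \<beta> @ E # Nbar # \<gamma>)"
  using zz_from_append[of 0 \<beta> 0 \<gamma>] by (simp_all add: zigzag_iff)

lemma zigzag_cases:
  assumes "zigzag_knight_path p"
  obtains "p = []"
  | \<beta> where "zigzag_knight_path \<beta>" "p = E # Ebar # \<beta>"
  | \<beta> where "zigzag_knight_path \<beta>" "p = N # Nbar # \<beta>"
  | \<beta> \<gamma> where "zigzag_knight_path \<beta>" "zigzag_knight_path \<gamma>" "p = N # Ebar # \<beta> @ E # Nbar # \<gamma>"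
  using assms
  by (cases "(0 :: nat, p)" rule: zz_from.cases)
    (auto simp: zigzag_iff dest!: zz_from_first_return)

lemma zigzag_unique:
  assumes "zigzag_knight_path \<beta>" "zigzag_knight_path \<beta>'"
  shows "\<beta> @ E # Nbar # \<gamma> = \<beta>' @ E # Nbar # \<gamma>' \<longleftrightarrow> \<beta> = \<beta>' \<and> \<gamma> = \<gamma>'"
  using assms zz_from_unique[of 0 \<beta> \<beta>' \<gamma> \<gamma>'] by (auto simp only: zigzag_iff)

text \<open>The value on words that are not zigzag knight's paths is irrelevant.\<close>

function psi :: "knight_step list \<Rightarrow> motzkin_step list" where
  "psi [] = [F]"
| "zigzag_knight_path \<beta> \<Longrightarrow> psi (E # Ebar # \<beta>) = U # psi \<beta> @ [D]"
| "zigzag_knight_path \<beta> \<Longrightarrow> psi (N # Nbar # \<beta>) = F # psi \<beta>"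
| "zigzag_knight_path \<beta> \<Longrightarrow> zigzag_knight_path \<gamma> \<Longrightarrow>
     psi (N # Ebar # \<beta> @ E # Nbar # \<gamma>) = U # psi \<beta> @ D # psi \<gamma>"
| "\<not> zigzag_knight_path p \<Longrightarrow> psi p = undefined"
proof -
  fix P and x :: "knight_step list"
  assume "x = [] \<Longrightarrow> P"
    "\<And>\<beta>. zigzag_knight_path \<beta> \<Longrightarrow> x = E # Ebar # \<beta> \<Longrightarrow> P"
    "\<And>\<beta>. zigzag_knight_path \<beta> \<Longrightarrow> x = N # Nbar # \<beta> \<Longrightarrow> P"
    "\<And>\<beta> \<gamma>. zigzag_knight_path \<beta> \<Longrightarrow> zigzag_knight_path \<gamma> \<Longrightarrow>
       x = N # Ebar # \<beta> @ E # Nbar # \<gamma> \<Longrightarrow> P"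
    "\<And>p. \<not> zigzag_knight_path p \<Longrightarrow> x = p \<Longrightarrow> P"
  then show P by (metis zigzag_cases)
qed (auto simp: zigzag_Nil zigzag_EE zigzag_NN zigzag_NE zigzag_unique)
termination by (relation "measure length") auto

end

theory Submission
  imports Defs
begin

text \<open>Cutting a nonempty peakless Motzkin path at its first return to the axis writes it uniquely as
  \<open>F\<close>, \<open>F q\<close>, \<open>U q D\<close> or \<open>U q D r\<close> with \<open>q\<close> and \<open>r\<close> nonempty peakless Motzkin paths, where
  \<open>q \<noteq> \<epsilon>\<close> after \<open>U\<close> is exactly the absence of a peak. These four forms match the four clauses of
  \<^const>\<open>psi\<close>, whose values are nonempty. Each clause adds half the size that it consumes, up
  to the shift by one caused by \<open>psi \<epsilon> = F\<close>.\<close>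

text \<open>The unspecified value of \<open>hd []\<close> is harmless: \<open>motzkin_from (Suc h) []\<close> is false.\<close>

fun motzkin_from :: "nat \<Rightarrow> motzkin_step list \<Rightarrow> bool" where
  "motzkin_from h [] = (h = 0)"
| "motzkin_from h (F # p) = motzkin_from h p"
| "motzkin_from h (U # p) = (motzkin_from (Suc h) p \<and> hd p \<noteq> D)"
| "motzkin_from (Suc h) (D # p) = motzkin_from h p"
| "motzkin_from 0 (D # p) = False"

lemma fst_endpoint_motzkin: "fst (endpoint motzkin_vec p) = int (length p)"
proof (induction p)
  case (Cons s p)
  then show ?case by (cases s) auto
qed simp

lemma all_le_length_Cons:
  "(\<forall>k\<le>length (s # p). P k) \<longleftrightarrow> P 0 \<and> (\<forall>k\<le>length p. P (Suc k))"
  using All_less_Suc2[of "Suc (length p)" P] by (simp add: less_Suc_eq_le)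

lemma motzkin_from_iff:
  "motzkin_from h p \<longleftrightarrow>
     (\<forall>k\<le>length p. 0 \<le> int h + snd (endpoint motzkin_vec (take k p))) \<and>
     int h + snd (endpoint motzkin_vec p) = 0 \<and> \<not> sublist [U, D] p"
proof (induction h p rule: motzkin_from.induct)
  case (2 h p)
  then show ?case
    unfolding all_le_length_Cons by (auto simp: sublist_Cons_right)
next
  case (3 h p)
  have "prefix [U, D] (U # p) \<longleftrightarrow> p \<noteq> [] \<and> hd p = D"
    by (cases p) auto
  moreover have "p \<noteq> []" if "motzkin_from (Suc h) p"
    using that by auto
  ultimately show ?case
    using 3 unfolding all_le_length_Cons
    by (auto simp: sublist_Cons_right algebra_simps)
next
  case (4 h p)
  then show ?case
    unfolding all_le_length_Cons by (auto simp: sublist_Cons_right)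
next
  case (5 p)
  \<comment> \<open>The vertex after this first \<open>D\<close>, given by \<open>k = 0\<close>,
    already lies below the axis.\<close>
  show ?case
    unfolding all_le_length_Cons by (auto intro!: exI[of _ 0])
qed auto

lemma peakless_motzkin_paths_iff:
  "p \<in> peakless_motzkin_paths n \<longleftrightarrow> motzkin_from 0 p \<and> length p = n"
  unfolding peakless_motzkin_paths_def motzkin_from_iff in_quadrant_def
  by (auto simp: mem_Times_iff fst_endpoint_motzkin prod_eq_iff)

text \<open>Since \<open>q\<close> ends at height 0, its last step is never \<open>U\<close>, so the
  appended \<open>D\<close> creates no peak.\<close>

lemma motzkin_from_append:
  "motzkin_from k q \<Longrightarrow> motzkin_from (Suc (k + j)) (q @ D # r) = motzkin_from j r"
  by (induction k q rule: motzkin_from.induct) (auto simp: hd_append)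

text \<open>The cut is made at the first step below the starting height. After an initial
  \<open>U\<close> two such cuts are needed, the second inside the remainder of the first, hence the
  induction on length.\<close>

lemma motzkin_from_first_return:
  "motzkin_from (Suc h) p \<Longrightarrow> \<exists>q r. p = q @ D # r \<and> motzkin_from 0 q \<and> motzkin_from h r"
proof (induction "length p" arbitrary: h p rule: less_induct)
  case less
  from less.prems show ?case
  proof (cases "(Suc h, p)" rule: motzkin_from.cases)
    case (2 h' p')
    then obtain q r where "p' = q @ D # r" "motzkin_from 0 q" "motzkin_from h r"
      using less.hyps[of p' h] less.prems by auto
    with 2 show ?thesis by (intro exI[of _ "F # q"] exI[of _ r]) auto
  next
    case (3 h' p')
    then obtain q r where 1: "p' = q @ D # r" "motzkin_from 0 q" "motzkin_from (Suc h) r"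
      using less.hyps[of p' "Suc h"] less.prems by auto
    then obtain q' r' where 2: "r = q' @ D # r'" "motzkin_from 0 q'" "motzkin_from h r'"
      using less.hyps[of r h] 3 by auto
    \<comment> \<open>As \<open>p'\<close> follows a \<open>U\<close>, it does not begin with
      \<open>D\<close>, which forces \<open>q\<close> to be nonempty.\<close>
    have "hd (q @ D # q') \<noteq> D"
      using 1 3 less.prems by (cases q) auto
    with 1 2 3 motzkin_from_append[of 0 q 0 q'] show ?thesis
      by (intro exI[of _ "U # q @ D # q'"] exI[of _ r']) auto
  next
    case (4 h' p')
    with less.prems show ?thesis by (intro exI[of _ "[]"] exI[of _ p']) auto
  qed auto
qed

text \<open>The \<open>D\<close> after \<open>q\<close> is the first step to go below the axis, and
  this fixes the place of the cut.\<close>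

lemma motzkin_from_unique:
  "motzkin_from k q \<Longrightarrow> motzkin_from k q' \<Longrightarrow> q @ D # r = q' @ D # r' \<Longrightarrow> q = q' \<and> r = r'"
proof (induction k q arbitrary: q' rule: motzkin_from.induct)
  case (1 h)
  then show ?case by (cases "(h, q')" rule: motzkin_from.cases) auto
next
  case (2 h p)
  then show ?case by (cases "(h, q')" rule: motzkin_from.cases) auto
next
  case (3 h p)
  then show ?case by (cases "(h, q')" rule: motzkin_from.cases) auto
next
  case (4 h p)
  then show ?case by (cases "(Suc h, q')" rule: motzkin_from.cases) auto
qed auto

lemma motzkin_from_U_D:
  assumes "motzkin_from 0 q" "q \<noteq> []" "motzkin_from 0 r"
  shows "motzkin_from 0 (U # q @ D # r)"
  using assms motzkin_from_append[of 0 q 0 r] by (cases q) auto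

lemma motzkin_cases:
  assumes "motzkin_from 0 p"
  obtains "p = []"
  | q where "motzkin_from 0 q" "p = F # q"
  | q r where "motzkin_from 0 q" "q \<noteq> []" "motzkin_from 0 r" "p = U # q @ D # r"
  using assms
  by (cases "(0 :: nat, p)" rule: motzkin_from.cases)
    (auto simp: hd_append split: if_splits dest!: motzkin_from_first_return)

lemma psi_nonempty [simp]:
  assumes "zigzag_knight_path p"
  shows "psi p \<noteq> []" "[] \<noteq> psi p"
  using assms by (cases rule: zigzag_cases; simp)+

lemma motzkin_from_psi: "zigzag_knight_path p \<Longrightarrow> motzkin_from 0 (psi p)"
  \<comment> \<open>Keeping the \<open>U\<close> clause folded lets \<open>motzkin_from_U_D\<close>
    apply, with \<open>r = []\<close> for \<open>E # Ebar # \<beta>\<close>.\<close>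
  by (induction p rule: psi.induct) (auto intro!: motzkin_from_U_D simp del: motzkin_from.simps(3))

lemma psi_append_D_eq_iff:
  assumes "zigzag_knight_path p" "zigzag_knight_path q"
  shows "psi p @ D # r = psi q @ D # s \<longleftrightarrow> psi p = psi q \<and> r = s"
  using motzkin_from_unique[OF motzkin_from_psi[OF assms(1)] motzkin_from_psi[OF assms(2)]]
  by auto

lemma path_size_simps [simp]:
  "path_size [] = 0"
  "path_size (s # p) = fst (knight_vec s) + path_size p"
  "path_size (p @ q) = path_size p + path_size q"
  by (simp_all add: path_size_def endpoint_def)

text \<open>In the clause with two recursive calls, four steps of total size 6 yield only two
  letters; the third is the extra letter of the second image.\<close>

lemma length_psi: "zigzag_knight_path p \<Longrightarrow> 2 * int (length (psi p)) = path_size p + 2"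
  by (induction p rule: psi.induct) auto

text \<open>The first letter separates the clauses giving \<open>F\<close> from those giving
  \<open>U\<close>. Within each pair, nonemptiness of images decides, for \<open>U\<close> after
  cutting at the first return.\<close>

lemma psi_inj:
  "zigzag_knight_path p \<Longrightarrow> zigzag_knight_path p' \<Longrightarrow> psi p = psi p' \<Longrightarrow> p = p'"
proof (induction p arbitrary: p' rule: psi.induct)
  case 1
  from 1(2) show ?case
    by (cases rule: zigzag_cases) (use 1 in auto)
next
  case (2 \<beta>)
  from 2(4) show ?case
    \<comment> \<open>Here \<open>[]\<close> is what follows the closing \<open>D\<close>; a match
      with the two-call clause would make some image empty.\<close>
    by (cases rule: zigzag_cases) (use "2.hyps" "2.prems" psi_append_D_eq_iff[of _ _ "[]"]
        in \<open>auto intro: "2.IH"\<close>)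
next
  case (3 \<beta>)
  from 3(4) show ?case
    by (cases rule: zigzag_cases) (use "3.hyps" "3.prems" in \<open>auto intro: "3.IH"\<close>)
next
  case (4 \<beta> \<gamma>)
  from 4(6) show ?case
    by (cases rule: zigzag_cases) (use "4.hyps" "4.prems" psi_append_D_eq_iff[of _ _ _ "[]"]
        in \<open>auto simp: psi_append_D_eq_iff zigzag_unique intro: "4.IH"\<close>)
qed auto

lemma psi_surj:
  "motzkin_from 0 m \<Longrightarrow> m \<noteq> [] \<Longrightarrow> \<exists>p. zigzag_knight_path p \<and> psi p = m"
proof (induction "length m" arbitrary: m rule: less_induct)
  case less
  from less.prems(1) show ?case
  proof (cases rule: motzkin_cases)
    case 1
    with less.prems show ?thesis by simp
  next
    case (2 q)
    show ?thesis
    \<comment> \<open>No image is empty, so \<open>F\<close> alone must come from the empty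
      path.\<close>
    proof (cases "q = []")
      case True
      with 2 zigzag_Nil show ?thesis by (intro exI[of _ "[]"]) simp
    next
      case False
      with 2 less.hyps[of q] obtain \<beta> where "zigzag_knight_path \<beta>" "psi \<beta> = q" by auto
      with 2 zigzag_NN show ?thesis by (intro exI[of _ "N # Nbar # \<beta>"]) simp
    qed
  next
    case (3 q r)
    with less.hyps[of q] obtain \<beta> where \<beta>: "zigzag_knight_path \<beta>" "psi \<beta> = q" by auto
    show ?thesis
    \<comment> \<open>Whether anything follows the first return decides between
      \<open>E # Ebar\<close> and \<open>N # Ebar\<close>.\<close>
    proof (cases "r = []")
      case True
      with 3 \<beta> zigzag_EE show ?thesis by (intro exI[of _ "E # Ebar # \<beta>"]) simp
    next
      case False
      with 3 less.hyps[of r] obtain \<gamma> where "zigzag_knight_path \<gamma>" "psi \<gamma> = r" by auto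
      with 3 \<beta> zigzag_NE show ?thesis
        by (intro exI[of _ "N # Ebar # \<beta> @ E # Nbar # \<gamma>"]) simp
    qed
  qed
qed

theorem theorem3:
  fixes n :: nat
  shows "bij_betw psi (zigzag_knight_paths n) (peakless_motzkin_paths (n + 1))"
proof (rule bij_betw_imageI)
  show "inj_on psi (zigzag_knight_paths n)"
    by (auto simp: inj_on_def zigzag_knight_paths_def intro: psi_inj)
  have size: "path_size p = 2 * int n \<longleftrightarrow> length (psi p) = n + 1"
    if "zigzag_knight_path p" for p
    using length_psi[OF that] by linarith
  show "psi ` zigzag_knight_paths n = peakless_motzkin_paths (n + 1)"
  proof (intro equalityI subsetI)
    fix m assume "m \<in> psi ` zigzag_knight_paths n"
    then show "m \<in> peakless_motzkin_paths (n + 1)"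
      using size motzkin_from_psi
      by (auto simp: zigzag_knight_paths_def peakless_motzkin_paths_iff)
  next
    fix m assume m: "m \<in> peakless_motzkin_paths (n + 1)"
    \<comment> \<open>The length \<open>n + 1\<close> is positive, which excludes the one peakless
      path without a preimage.\<close>
    then have "motzkin_from 0 m" "m \<noteq> []"
      by (auto simp: peakless_motzkin_paths_iff)
    then obtain p where "zigzag_knight_path p" "psi p = m"
      using psi_surj by blast
    then show "m \<in> psi ` zigzag_knight_paths n"
      using m size by (auto simp: zigzag_knight_paths_def peakless_motzkin_paths_iff)
  qed
qed

end
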